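(* $LAvg$ is not accumulated; that is, there exists a bounded $H\subset\mathbb{R}$ such that $LAvg(H)$ and $LAvg(H')$ both exist and $LAvg(H')\ne LAvg(H)$.
   Context: For $H\subset\mathbb{R}$, $\delta>0$: $S(H,\delta)=\{y\in\mathbb{R}:\exists x\in H,\ |x-y|<\delta\}$. $\lambda$ is Lebesgue measure; for bounded measurable $K$ with $\lambda(K)>0$, $Avg(K)=\frac{\int_K x\,d\lambda}{\lambda(K)}$. $LAvg(H)=\lim_{\delta\to 0+0}Avg(S(H,\delta))$ (for nonempty bounded $H$) if the limit exists. $H'$ is the set of accumulation points of $H$. A function $\mathcal{K}$ on some bounded subsets of $\mathbb{R}$ is accumulated if $H,H'\in Dom(\mathcal{K})$ implies $\mathcal{K}(H')=\mathcal{K}(H)$. *)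

theory Defs
  imports "HOL-Analysis.Analysis"
begin

definition nbhd :: "real set \<Rightarrow> real \<Rightarrow> real set" where
  "nbhd H \<delta> = {y. \<exists>x\<in>H. \<bar>x - y\<bar> < \<delta>}"

(* Meant for bounded Lebesgue measurable K of positive measure. Elsewhere the value carries no
   meaning; LAvg only applies Avg to nbhd H \<delta> with H nonempty and bounded and \<delta> > 0,
   which is a nonempty bounded open set. *)
definition Avg :: "real set \<Rightarrow> real" where
  "Avg K = (LINT x:K|lebesgue. x) / measure lebesgue K"

(* Partially defined means are option-valued: None outside the domain, so that the domain is
   the library's dom. *)
definition LAvg :: "real set \<Rightarrow> real option" where
  "LAvg H =
     (if H \<noteq> {} \<and> bounded H \<and> (\<exists>L. ((\<lambda>\<delta>. Avg (nbhd H \<delta>)) \<longlongrightarrow> L) (at_right 0))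
      then Some (Lim (at_right 0) (\<lambda>\<delta>. Avg (nbhd H \<delta>)))
      else None)"

definition acc_points :: "real set \<Rightarrow> real set" where
  "acc_points H = {x. x islimpt H}"

definition accumulated :: "(real set \<Rightarrow> real option) \<Rightarrow> bool" where
  "accumulated \<K> \<longleftrightarrow>
     (\<forall>H. H \<in> dom \<K> \<and> acc_points H \<in> dom \<K> \<longrightarrow> \<K> (acc_points H) = \<K> H)"

end

theory Submission
  imports Defs "HOL-Real_Asymp.Real_Asymp"
begin

text \<open>Near a point where a convergent sequence accumulates, the \<open>\<delta>\<close>-neighbourhood is the
  larger the slower the sequence converges. Take the union of \<open>1 / n\<close>, which converges to 0, and
  \<open>1 + 1 / n\<^sup>3\<close>, which converges to 1. Its \<open>\<delta>\<close>-neighbourhood has measure at least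
  \<open>sqrt \<delta>\<close>, of which only \<open>O(\<delta> powr (3/4))\<close> lies outside any given neighbourhood of 0.
  Hence its mean is 0, whereas the set \<open>{0, 1}\<close> of its accumulation points has mean \<open>1/2\<close>.\<close>

section \<open>Neighbourhoods and bounds for means\<close>

lemma nbhd_conv_ball: "nbhd H \<delta> = (\<Union>x\<in>H. ball x \<delta>)"
  by (auto simp: nbhd_def dist_real_def)

lemma nbhd_subset_Icc:
  assumes "H \<subseteq> {a..b}"
  shows "nbhd H \<delta> \<subseteq> {a - \<delta>..b + \<delta>}"
  using assms by (force simp: nbhd_def)

lemma lmeasurable_nbhd:
  assumes "bounded H"
  shows "nbhd H \<delta> \<in> lmeasurable"
proof (rule lmeasurable_open)
  obtain a where "H \<subseteq> {- a..a}"
    by (rule bounded_subset_cbox_symmetric[OF assms]) simp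
  then show "bounded (nbhd H \<delta>)"
    by (rule bounded_subset[OF bounded_closed_interval nbhd_subset_Icc])
qed (simp add: nbhd_conv_ball open_UN)

lemma LAvg_eq_SomeI:
  assumes "H \<noteq> {}" "bounded H" "((\<lambda>\<delta>. Avg (nbhd H \<delta>)) \<longlongrightarrow> L) (at_right 0)"
  shows "LAvg H = Some L"
  using assms tendsto_Lim[OF _ assms(3)] unfolding LAvg_def by auto

lemma set_integrable_ident:
  fixes A :: "real set"
  assumes "A \<in> sets lebesgue" "A \<subseteq> {a..b}"
  shows "set_integrable lebesgue A (\<lambda>x. x)"
  by (rule set_integrable_subset[OF _ assms])
     (intro absolutely_integrable_continuous_real continuous_intros)

lemma abs_integral_ident_le:
  fixes A :: "real set"
  assumes "A \<in> lmeasurable" "A \<subseteq> {- c..c}"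
  shows "\<bar>LINT x:A|lebesgue. x\<bar> \<le> c * measure lebesgue A"
proof -
  have int: "set_integrable lebesgue A (\<lambda>x. x)"
    using assms set_integrable_ident by (blast dest: fmeasurableD)
  have fin: "emeasure lebesgue A \<noteq> \<infinity>"
    using fmeasurableD2[OF assms(1)] by simp
  have "\<bar>LINT x:A|lebesgue. x\<bar> \<le> (LINT x:A|lebesgue. \<bar>x\<bar>)"
    using set_integral_norm_bound[OF int] by simp
  also have "\<dots> \<le> (LINT x:A|lebesgue. c)"
  proof (rule set_integral_mono)
    show "set_integrable lebesgue A (\<lambda>x. \<bar>x\<bar>)"
      using set_integrable_norm[OF int] by simp
    show "set_integrable lebesgue A (\<lambda>x. c)"
      using assms(1) fin by (simp add: set_integrable_def fmeasurableD top.not_eq_extremum)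
  qed (use assms(2) in fastforce)
  also have "\<dots> = c * measure lebesgue A"
    using set_integral_const[OF fmeasurableD[OF assms(1)] fin, of c] by simp
  finally show ?thesis .
qed

text \<open>Cutting \<open>K\<close> at \<open>{- \<epsilon>..\<epsilon>}\<close> bounds the
  integrand by \<open>\<epsilon>\<close> inside and by \<open>b\<close> outside. The mean is thus
  forced towards 0 once the share of \<open>K\<close> lying outside tends to 0.\<close>

lemma abs_Avg_le:
  assumes K: "K \<in> lmeasurable" "K \<subseteq> {- b..b}" "measure lebesgue K > 0" and "\<epsilon> > 0"
  shows "\<bar>Avg K\<bar> \<le> \<epsilon> + b * (measure lebesgue (K - {- \<epsilon>..\<epsilon>}) / measure lebesgue K)"
proof -
  let ?A = "K \<inter> {- \<epsilon>..\<epsilon>}" and ?B = "K - {- \<epsilon>..\<epsilon>}"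
  have A: "?A \<in> lmeasurable" and B: "?B \<in> lmeasurable"
    using K(1) by (auto intro: fmeasurable_Int_fmeasurable fmeasurable_Diff)
  have "(LINT x:?A \<union> ?B|lebesgue. x) = (LINT x:?A|lebesgue. x) + (LINT x:?B|lebesgue. x)"
    using A B K(2) by (intro set_integral_Un set_integrable_ident[of _ "- b" b]) (auto dest: fmeasurableD)
  moreover have "?A \<union> ?B = K" by auto
  ultimately have "\<bar>LINT x:K|lebesgue. x\<bar> \<le> \<bar>LINT x:?A|lebesgue. x\<bar> + \<bar>LINT x:?B|lebesgue. x\<bar>"
    by simp
  also have "\<dots> \<le> \<epsilon> * measure lebesgue ?A + b * measure lebesgue ?B"
    using K(2) by (intro add_mono abs_integral_ident_le A B) auto
  also have "\<dots> \<le> \<epsilon> * measure lebesgue K + b * measure lebesgue ?B"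
    using A K(1) \<open>\<epsilon> > 0\<close> by (auto intro!: measure_mono_fmeasurable dest: fmeasurableD)
  finally show ?thesis
    using K(3) by (simp add: Avg_def field_simps)
qed

section \<open>The mean of the two-point set\<close>

lemma measure_lebesgue_ball_real:
  fixes x :: real
  assumes "\<delta> \<ge> 0"
  shows "measure lebesgue (ball x \<delta>) = 2 * \<delta>"
  using assms by (simp add: ball_eq_greaterThanLessThan)

text \<open>For such \<open>\<delta>\<close> the balls around 0 and 1 are disjoint. By symmetry they
  contribute 0 and \<open>2 * \<delta>\<close> to the integral, and their total length is
  \<open>4 * \<delta>\<close>.\<close>

lemma Avg_nbhd_01:
  assumes "0 < \<delta>" "\<delta> < 1/2"
  shows "Avg (nbhd {0, 1} \<delta>) = 1/2"
proof -
  let ?A = "{-\<delta><..<\<delta>}" and ?B = "{1-\<delta><..<1+\<delta>}"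
  have K: "nbhd {0, 1} \<delta> = ?A \<union> ?B"
    by (auto simp: nbhd_def)
  have disj: "?A \<inter> ?B = {}"
    using assms by auto
  have "((\<lambda>x. x) has_integral (\<delta>\<^sup>2 - (-\<delta>)\<^sup>2)/2 + ((1+\<delta>)\<^sup>2 - (1-\<delta>)\<^sup>2)/2) (?A \<union> ?B)"
    using assms disj ident_has_integral[of "-\<delta>" \<delta>] ident_has_integral[of "1-\<delta>" "1+\<delta>"]
    by (intro has_integral_Un) (auto simp: has_integral_Icc_iff_Ioo)
  then have "integral (?A \<union> ?B) (\<lambda>x. x) = 2 * \<delta>"
    by (simp add: integral_unique power2_eq_square field_simps)
  moreover have "set_integrable lebesgue (?A \<union> ?B) (\<lambda>x. x)"
    using assms by (intro set_integrable_ident[of _ "-1" 2]) auto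
  ultimately have "(LINT x:?A \<union> ?B|lebesgue. x) = 2 * \<delta>"
    using set_lebesgue_integral_eq_integral(2) by metis
  moreover have "measure lebesgue (?A \<union> ?B) = measure lebesgue ?A + measure lebesgue ?B"
    using disj by (intro measure_Un3[THEN trans]) auto
  then have "measure lebesgue (?A \<union> ?B) = 4 * \<delta>"
    using assms by simp
  ultimately show ?thesis
    using assms by (simp add: Avg_def K)
qed

lemma LAvg_01: "LAvg {0, 1} = Some (1/2)"
proof (rule LAvg_eq_SomeI)
  have "\<forall>\<^sub>F \<delta> in at_right 0. \<delta> \<in> {0<..<1/2 :: real}"
    by (rule eventually_at_right_real) simp
  then have "\<forall>\<^sub>F \<delta> in at_right 0. Avg (nbhd {0, 1} \<delta>) = 1/2"
  proof eventually_elim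
    case (elim \<delta>)
    then show ?case
      by (intro Avg_nbhd_01) auto
  qed
  then show "((\<lambda>\<delta>. Avg (nbhd {0, 1} \<delta>)) \<longlongrightarrow> 1/2) (at_right 0)"
    by (rule tendsto_eventually)
qed auto

section \<open>The example set: accumulation points and measure estimates\<close>

lemma acc_points_range:
  assumes "X \<longlonglongrightarrow> l" "\<And>n. X n \<noteq> l"
  shows "acc_points (range X) = {l}"
proof -
  \<comment> \<open>The terms avoid \<open>l\<close>, so \<open>X\<close> itself is a witnessing
    sequence.\<close>
  have "l islimpt range X"
    unfolding islimpt_sequential using assms by (intro exI[of _ X]) simp
  moreover have "l' = l" if "l' islimpt range X" for l'
    by (rule sequence_unique_limpt[OF assms(1) that])
  ultimately show ?thesis
    unfolding acc_points_def by blast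
qed

definition slow :: "nat \<Rightarrow> real" where
  "slow n = 1 / real (Suc n)"

text \<open>With exponent p in place of 3, the part of the neighbourhood near 1 has measure of order
  \<open>\<delta> powr (p/(p+1))\<close>. For p = 3 this is \<open>\<delta> powr (3/4)\<close>, of
  smaller order than the \<open>sqrt \<delta>\<close> coming from \<open>slow\<close>, which has p =
  1.\<close>

definition fast :: "nat \<Rightarrow> real" where
  "fast n = 1 + 1 / real (Suc n) ^ 3"

definition two_rates :: "real set" where
  "two_rates = range slow \<union> range fast"

lemma two_rates_subset: "two_rates \<subseteq> {0..2}"
proof -
  have "slow n \<in> {0..2}" "fast n \<in> {0..2}" for n
  proof -
    have "0 \<le> 1 / real (Suc n)" "1 / real (Suc n) \<le> 1"
      by simp_all
    moreover have "1 \<le> real (Suc n) ^ 3"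
      by (rule one_le_power) simp
    then have "0 \<le> 1 / real (Suc n) ^ 3" "1 / real (Suc n) ^ 3 \<le> 1"
      by (simp_all only: divide_le_eq_1_pos zero_le_divide_1_iff)
    ultimately show "slow n \<in> {0..2}" "fast n \<in> {0..2}"
      unfolding slow_def fast_def atLeastAtMost_iff by linarith+
  qed
  then show ?thesis
    by (auto simp: two_rates_def)
qed

lemma bounded_two_rates: "bounded two_rates"
  using two_rates_subset bounded_closed_interval bounded_subset by blast

lemma acc_points_two_rates: "acc_points two_rates = {0, 1}"
proof -
  have Un: "acc_points two_rates = acc_points (range slow) \<union> acc_points (range fast)"
    by (auto simp: acc_points_def two_rates_def islimpt_Un)
  have "slow \<longlonglongrightarrow> 0" "fast \<longlonglongrightarrow> 1"
    unfolding slow_def fast_def by real_asymp+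
  moreover have "slow n \<noteq> 0" "fast n \<noteq> 1" for n
    by (simp_all add: slow_def fast_def)
  ultimately have "acc_points (range slow) = {0}" "acc_points (range fast) = {1}"
    by (simp_all add: acc_points_range)
  then show ?thesis
    unfolding Un by auto
qed

text \<open>Consecutive terms of \<^const>\<open>slow\<close> around \<open>y\<close> are about \<open>y\<^sup>2\<close> apart, so
  their \<open>\<delta>\<close>-balls already cover everything up to \<open>sqrt \<delta>\<close>.\<close>

lemma measure_nbhd_two_rates_ge:
  assumes "\<delta> > 0"
  shows "sqrt \<delta> \<le> measure lebesgue (nbhd two_rates \<delta>)"
proof -
  have "{0<..<sqrt \<delta>} \<subseteq> nbhd two_rates \<delta>"
  proof
    fix y assume y: "y \<in> {0<..<sqrt \<delta>}"
    \<comment> \<open>As \<open>slow n\<close> is 1/(n+1), this picks the largest term of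
      \<open>slow\<close> strictly below \<open>y\<close>.\<close>
    define n where "n = nat \<lfloor>1 / y\<rfloor>"
    have n: "real n \<le> 1 / y" "1 / y < real (Suc n)"
      using y floor_correct[of "1 / y"] unfolding n_def by (auto simp: add.commute)
    have "y - slow n \<ge> 0" "y - slow n \<le> y * y"
    proof -
      show "y - slow n \<ge> 0"
        using n(2) y by (simp add: slow_def field_simps)
      \<comment> \<open>The left side is n+1 times the gap \<open>y - slow n\<close>. It is bounded
        by \<open>y\<close> because yn is at most 1, then by n+1 times \<open>y * y\<close> because
        y(n+1) exceeds 1.\<close>
      have "y * real (Suc n) - 1 \<le> y"
        using n(1) y by (simp add: field_simps)
      also have "y \<le> y * (y * real (Suc n))"
        using n(2) y mult_left_mono[of 1 "y * real (Suc n)" y] by (simp add: field_simps)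
      finally show "y - slow n \<le> y * y"
        by (simp add: slow_def field_simps)
    qed
    moreover have "y * y < \<delta>"
      using y assms power_strict_mono[of y "sqrt \<delta>" 2] by (simp add: power2_eq_square)
    ultimately have "\<bar>slow n - y\<bar> < \<delta>"
      by linarith
    then show "y \<in> nbhd two_rates \<delta>"
      unfolding nbhd_def two_rates_def by blast
  qed
  then have "measure lebesgue {0<..<sqrt \<delta>} \<le> measure lebesgue (nbhd two_rates \<delta>)"
    using lmeasurable_nbhd[OF bounded_two_rates] by (intro measure_mono_fmeasurable) auto
  then show ?thesis
    using assms by simp
qed

text \<open>Only finitely many balls around terms of \<open>slow\<close> leave
  \<open>{- \<epsilon>..\<epsilon>}\<close>, and their number is bounded in terms of
  \<open>\<epsilon>\<close> alone. The terms of \<open>fast\<close> from index \<open>N\<close> on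
  share one interval near 1, the earlier ones get a ball each. \<open>N\<close> stays free so that
  it can later depend on \<open>\<delta>\<close>.\<close>

lemma nbhd_two_rates_away_subset:
  assumes "0 < \<delta>" "2 * \<delta> < \<epsilon>" "2 / \<epsilon> \<le> real M"
  shows "nbhd two_rates \<delta> - {- \<epsilon>..\<epsilon>} \<subseteq>
    (\<Union>n<M. ball (slow n) \<delta>) \<union> {1 - \<delta>..1 + 1 / real (Suc N) ^ 3 + \<delta>} \<union> (\<Union>n<N. ball (fast n) \<delta>)"
proof
  fix y assume y: "y \<in> nbhd two_rates \<delta> - {- \<epsilon>..\<epsilon>}"
  then consider n where "y \<in> ball (slow n) \<delta>" | n where "y \<in> ball (fast n) \<delta>"
    by (auto simp: nbhd_conv_ball two_rates_def)
  then show "y \<in> (\<Union>n<M. ball (slow n) \<delta>) \<union> {1 - \<delta>..1 + 1 / real (Suc N) ^ 3 + \<delta>} \<union> (\<Union>n<N. ball (fast n) \<delta>)"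
  proof cases
    case (1 n)
    have "slow n > 0"
      by (simp add: slow_def)
    \<comment> \<open>The radius is below \<open>\<epsilon> / 2\<close>, so a ball leaving
      \<open>{- \<epsilon>..\<epsilon>}\<close> has its centre beyond \<open>\<epsilon> / 2\<close>
      in absolute value; the centre is positive.\<close>
    then have "slow n > \<epsilon> / 2"
      using 1 y assms(1,2) by (auto simp: dist_real_def)
    then have "real (Suc n) < 2 / \<epsilon>"
      using assms(1,2) by (simp add: slow_def field_simps)
    then have "n < M"
      using assms(3) by linarith
    then show ?thesis
      using 1 by blast
  next
    case (2 n)
    show ?thesis
    proof (cases "n < N")
      case False
      then have "1 / real (Suc n) ^ 3 \<le> 1 / real (Suc N) ^ 3"
        by (intro divide_left_mono power_mono) auto
      moreover have "fast n \<ge> 1"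
        by (simp add: fast_def)
      ultimately have "y \<in> {1 - \<delta>..1 + 1 / real (Suc N) ^ 3 + \<delta>}"
        using 2 unfolding mem_ball dist_real_def atLeastAtMost_iff fast_def by linarith
      then show ?thesis by blast
    qed (use 2 in blast)
  qed
qed

lemma measure_UN_ball_real_le:
  fixes X :: "nat \<Rightarrow> real"
  assumes "\<delta> \<ge> 0"
  shows "measure lebesgue (\<Union>n<N. ball (X n) \<delta>) \<le> real N * (2 * \<delta>)"
  using measure_UNION_le[of "{..<N}" "\<lambda>n. ball (X n) \<delta>" lebesgue]
  by (simp add: measure_lebesgue_ball_real[OF assms])

lemma measure_nbhd_two_rates_away_le:
  assumes "0 < \<delta>" "2 * \<delta> < \<epsilon>" "2 / \<epsilon> \<le> real M"
  shows "measure lebesgue (nbhd two_rates \<delta> - {- \<epsilon>..\<epsilon>}) \<le>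
    2 * \<delta> * (real M + 1) + 3 * \<delta> powr (3/4)"
proof -
  text \<open>This cut-off makes both error terms below, \<open>1 / (Suc N) ^ 3\<close> and \<open>\<delta> * N\<close>,
    at most of the order \<open>\<delta> powr (3/4)\<close>, which is negligible against \<open>sqrt \<delta>\<close>.\<close>
  define N where "N = nat \<lfloor>\<delta> powr (-1/4)\<rfloor>"
  have N: "real N \<le> \<delta> powr (-1/4)" "\<delta> powr (-1/4) \<le> real (Suc N)"
    by (auto simp: N_def le_nat_iff) linarith
  let ?A = "\<Union>n<M. ball (slow n) \<delta>" and ?C = "\<Union>n<N. ball (fast n) \<delta>"
  let ?B = "{1 - \<delta>..1 + 1 / real (Suc N) ^ 3 + \<delta>}"
  have lm: "?A \<in> lmeasurable" "?B \<in> lmeasurable" "?C \<in> lmeasurable"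
    by (auto intro!: fmeasurable.finite_UN)
  have "measure lebesgue (nbhd two_rates \<delta> - {- \<epsilon>..\<epsilon>}) \<le> measure lebesgue (?A \<union> ?B \<union> ?C)"
    using lm nbhd_two_rates_away_subset[OF assms, of N] lmeasurable_nbhd[OF bounded_two_rates, of \<delta>]
    by (intro measure_mono_fmeasurable fmeasurable.Un) (auto dest: fmeasurableD)
  also have "\<dots> \<le> measure lebesgue ?A + measure lebesgue ?B + measure lebesgue ?C"
    using lm by (intro order_trans[OF measure_Un_le] add_right_mono measure_Un_le) (auto dest: fmeasurableD)
  also have "\<dots> \<le> real M * (2 * \<delta>) + (2 * \<delta> + 1 / real (Suc N) ^ 3) + real N * (2 * \<delta>)"
    using assms(1) measure_UN_ball_real_le[of \<delta> slow M] measure_UN_ball_real_le[of \<delta> fast N]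
    by (intro add_mono) auto
  also have "\<dots> \<le> real M * (2 * \<delta>) + (2 * \<delta> + \<delta> powr (3/4)) + 2 * \<delta> powr (3/4)"
  proof (intro add_mono order_refl)
    have "1 / real (Suc N) ^ 3 \<le> 1 / (\<delta> powr (-1/4)) ^ 3"
      using N(2) assms(1) by (intro divide_left_mono power_mono) auto
    also have "\<dots> = \<delta> powr (3/4)"
      using assms(1) by (simp add: powr_power powr_minus field_simps)
    finally show "1 / real (Suc N) ^ 3 \<le> \<delta> powr (3/4)" .
    have "real N * (2 * \<delta>) \<le> \<delta> powr (-1/4) * (2 * \<delta>)"
      using N(1) assms(1) by (intro mult_right_mono) auto
    also have "\<dots> = 2 * \<delta> powr (3/4)"
      using assms(1) powr_add[of \<delta> "-1/4" 1] by simp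
    finally show "real N * (2 * \<delta>) \<le> 2 * \<delta> powr (3/4)" .
  qed
  finally show ?thesis
    by (simp add: algebra_simps)
qed

section \<open>The mean of the example set\<close>

lemma LAvg_two_rates: "LAvg two_rates = Some 0"
proof (rule LAvg_eq_SomeI)
  show "((\<lambda>\<delta>. Avg (nbhd two_rates \<delta>)) \<longlongrightarrow> 0) (at_right 0)"
  proof (rule tendstoI)
    fix r :: real assume "r > 0"
    \<comment> \<open>One half of \<open>r\<close> is for the part near 0, the other for the part
      away from it.\<close>
    define \<epsilon> where "\<epsilon> = r / 2"
    have "\<epsilon> > 0"
      using \<open>r > 0\<close> by (simp add: \<epsilon>_def)
    obtain M :: nat where M: "2 / \<epsilon> \<le> real M"
      using real_arch_simple by blast
    \<comment> \<open>\<open>?q\<close> bounds the share of the neighbourhood outside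
      \<open>{- \<epsilon>..\<epsilon>}\<close>: the upper bound for the far part over the lower
      bound for the whole. It tends to 0 because \<open>M\<close> depends on
      \<open>\<epsilon>\<close> only.\<close>
    let ?q = "\<lambda>\<delta>. (2 * \<delta> * (real M + 1) + 3 * \<delta> powr (3/4)) / sqrt \<delta>"
    have "((\<lambda>\<delta>. 3 * ?q \<delta>) \<longlongrightarrow> 0) (at_right 0)"
      by real_asymp
    then have "\<forall>\<^sub>F \<delta> in at_right 0. 3 * ?q \<delta> < \<epsilon>"
      using \<open>\<epsilon> > 0\<close> by (rule order_tendstoD)
    moreover have "\<forall>\<^sub>F \<delta> in at_right 0. \<delta> \<in> {0<..<min 1 (\<epsilon> / 2)}"
      using \<open>\<epsilon> > 0\<close> by (intro eventually_at_right_real) auto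
    ultimately show "\<forall>\<^sub>F \<delta> in at_right 0. dist (Avg (nbhd two_rates \<delta>)) 0 < r"
    proof eventually_elim
      case (elim \<delta>)
      let ?K = "nbhd two_rates \<delta>"
      have \<delta>: "0 < \<delta>" "\<delta> < 1" "2 * \<delta> < \<epsilon>"
        using elim(2) by auto
      \<comment> \<open>This is the source of the factor 3: for \<open>\<delta> < 1\<close> the
        neighbourhood of a subset of \<open>{0..2}\<close> stays within distance 3 of 0.\<close>
      have K: "?K \<subseteq> {- 3..3}"
        using nbhd_subset_Icc[OF two_rates_subset, of \<delta>] \<delta> by auto
      have pos: "0 < sqrt \<delta>" "0 < measure lebesgue ?K"
        using less_le_trans[OF _ measure_nbhd_two_rates_ge[of \<delta>]] \<delta>(1) by auto
      have "\<bar>Avg ?K\<bar> \<le> \<epsilon> + 3 * (measure lebesgue (?K - {- \<epsilon>..\<epsilon>}) / measure lebesgue ?K)"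
        by (rule abs_Avg_le[OF lmeasurable_nbhd[OF bounded_two_rates] K pos(2) \<open>\<epsilon> > 0\<close>])
      also have "\<dots> \<le> \<epsilon> + 3 * ?q \<delta>"
        using measure_nbhd_two_rates_away_le[OF \<delta>(1,3) M] measure_nbhd_two_rates_ge[OF \<delta>(1)] pos
        by (intro add_left_mono mult_left_mono frac_le) auto
      also have "\<dots> < r"
        using elim(1) unfolding \<epsilon>_def by linarith
      finally show ?case by simp
    qed
  qed
qed (simp add: two_rates_def, rule bounded_two_rates)

theorem proposition5p10:
  shows "\<not> accumulated LAvg \<and>
    (\<exists>H. bounded H \<and> H \<in> dom LAvg \<and> acc_points H \<in> dom LAvg \<and>
         the (LAvg (acc_points H)) \<noteq> the (LAvg H))"
proof
  have dom: "two_rates \<in> dom LAvg" "acc_points two_rates \<in> dom LAvg"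
    using LAvg_01 LAvg_two_rates unfolding acc_points_two_rates by (blast intro: domI)+
  \<comment> \<open>Both sides are \<open>the\<close> of a \<open>Some\<close>, with values 1/2 and
    0, so no unspecified value of \<open>the\<close> enters.\<close>
  have ne: "the (LAvg (acc_points two_rates)) \<noteq> the (LAvg two_rates)"
    by (simp add: acc_points_two_rates LAvg_01 LAvg_two_rates)
  then show "\<not> accumulated LAvg"
    using dom unfolding accumulated_def by metis
  show "\<exists>H. bounded H \<and> H \<in> dom LAvg \<and> acc_points H \<in> dom LAvg \<and>
         the (LAvg (acc_points H)) \<noteq> the (LAvg H)"
    using bounded_two_rates dom ne by blast
qed

end
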